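(* For every positive integer $n$ and every $x\neq 0$, $$\sum_{k=0}^{n}\binom nk(-2x)^{n-k}\;{}_4F_3\left[\begin{matrix}\frac{-n+k}{2},\ \frac{-n+k}{2}+1,\ \frac{-n+k}{2}+\frac12,\ \frac{-n+k}{2}+\frac12\\ -n+1,\ k+1,\ -n+1+k\end{matrix}\;\middle|\;\frac{4}{x^2}\right]T_k(x)=n\sum_{k=0}^{n}\left(1+(-1)^{n-k}\right)\frac{k(-2)^k}{(n+k)^2}\binom{\frac{n+k}{2}}{k}^2x^k+\cos\frac{\pi n}{2}.$$
   Context: The Chebyshev polynomials of the first kind $T_n(x)$ are defined by $\frac{1-xt}{1-2xt+t^2}=\sum_{n\ge 0}T_n(x)t^n$. The generalized hypergeometric function is ${}_4F_3\left[\begin{smallmatrix}a_1,a_2,a_3,a_4\\ b_1,b_2,b_3\end{smallmatrix}\middle| z\right]=\sum_{i\ge0}\frac{(a_1)_i(a_2)_i(a_3)_i(a_4)_i}{(b_1)_i(b_2)_i(b_3)_i}\frac{z^i}{i!}$, with $(a)_i=a(a+1)\cdots(a+i-1)$. Here one of the upper parameters is always a nonpositive integer and some lower parameters may also be nonpositive integers; the series is understood as terminating, i.e. as the finite sum over $0\le i\le\left[\frac{n-k}{2}\right]$ (for these $i$ no denominator vanishes). For arbitrary $a$ and integer $m\ge0$, $\binom am=a(a-1)\cdots(a-m+1)/m!$. *)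

theory Defs
  imports Complex_Main "HOL-Computational_Algebra.Formal_Power_Series"
begin

definition chebyshev_T :: "nat \<Rightarrow> 'a::field \<Rightarrow> 'a" where
  "chebyshev_T n x =
     fps_nth ((1 - fps_const x * fps_X) / (1 - fps_const (2 * x) * fps_X + fps_X ^ 2)) n"

(* A lower parameter may be a nonpositive integer, in which case the coefficients of the full
   series eventually have a zero denominator. The value of such a terminating series is its sum
   up to an explicit last index N, which has to be chosen so that no denominator with index at
   most N vanishes. *)
definition hypergeo_upto :: "nat \<Rightarrow> 'a::field_char_0 list \<Rightarrow> 'a list \<Rightarrow> 'a \<Rightarrow> 'a" where
  "hypergeo_upto N as bs z = (\<Sum>i\<le>N. fps_nth (fps_hypergeo as bs z) i)"

end

theory Submission
  imports Defs
begin

text \<open>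
  Write \<open>x = (w + 1/w) / 2\<close>, so that \<open>T\<^sub>k(x) = (w\<^sup>k + w\<^sup>-\<^sup>k) / 2\<close>. Expanding the hypergeometric terms turns
  the left-hand side into the sum of \<open>n/(n-i) C(n-i,j) C(i+j-1,i) (-2x)\<^sup>j T\<^sub>k(x)\<close> over all
  \<open>k + 2i + j = n\<close>. For \<open>j > 0\<close> and \<open>l = n - i - j\<close> the coefficient equals
  \<open>n/j C(i+j-1,i) C(l+j-1,l) (-2x)\<^sup>j\<close>, which is symmetric in \<open>i\<close> and \<open>l\<close>, while \<open>k = l - i\<close>. Hence
  the sum is half of the same sum with \<open>w\<^sup>l\<^sup>-\<^sup>i\<close> over all \<open>i + j + l = n\<close>, plus half of the diagonal
  \<open>i = l\<close>. The diagonal is the polynomial on the right-hand side, and the full sum is \<open>n\<close> times the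
  coefficient of \<open>t\<^sup>n\<close> in \<open>- log (1-U) - log (1-wt) - log (1-t/w) = - log (1+t\<^sup>2)\<close>, where
  \<open>U = -2xt / ((1-wt) (1-t/w))\<close>; this gives the cosine.
\<close>

unbundle fps_syntax

section \<open>Hypergeometric coefficients as products of binomial coefficients\<close>

lemma pochhammer_neg_of_nat:
  assumes "i \<le> m"
  shows "pochhammer (- of_nat m :: 'a::field_char_0) i = (-1) ^ i * fact m / fact (m - i)"
  using assms
proof (induction i)
  case (Suc i)
  then have *: "m - i = Suc (m - Suc i)" "(of_nat i :: 'a) - of_nat m = - of_nat (m - i)"
    by (auto simp: of_nat_diff)
  from Suc have "pochhammer (- of_nat m :: 'a) (Suc i) = (-1) ^ i * fact m / fact (m - i) * - of_nat (m - i)"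
    using *(2) by (simp add: pochhammer_Suc)
  also have "\<dots> = (-1) ^ Suc i * fact m / fact (m - Suc i)"
    unfolding *(1) fact_Suc by (simp add: field_simps del: of_nat_Suc)
  finally show ?case .
qed simp

lemma pochhammer_of_nat_add_one:
  "pochhammer (of_nat k + 1 :: 'a::field_char_0) i = fact (k + i) / fact k"
proof (induction i)
  case (Suc i)
  then show ?case by (simp add: pochhammer_Suc algebra_simps)
qed simp

text \<open>The duplication formula pairs \<open>m/2\<close> with \<open>m/2 + 1/2\<close> and
  \<open>m/2 + 1\<close> with the second \<open>m/2 + 1/2\<close>, giving
  \<open>pochhammer m (2 * i)\<close> and \<open>pochhammer (m + 1) (2 * i)\<close> up to powers of
  4. All parameters are then integers, so factorials suffice.\<close>

lemma hypergeo_coeff: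
  fixes x :: "'a::field_char_0"
  assumes "k < n" "2 * i \<le> n - k" "x \<noteq> 0"
  defines "m \<equiv> - of_nat n + of_nat k :: 'a"
  shows "of_nat (n choose k) * (- 2 * x) ^ (n - k) *
           fps_hypergeo [m / 2, m / 2 + 1, m / 2 + 1 / 2, m / 2 + 1 / 2]
             [- of_nat n + 1, of_nat k + 1, - of_nat n + 1 + of_nat k] (4 / x ^ 2) $ i
         = of_nat n / of_nat (n - i) * of_nat (n - i choose (n - k - 2 * i))
             * of_nat (n - k - i - 1 choose i) * (- 2 * x) ^ (n - k - 2 * i)"
proof -
  have d1: "pochhammer (m / 2) i * pochhammer (m / 2 + 1 / 2) i = pochhammer m (2 * i) / 4 ^ i"
    using pochhammer_double[of "m / 2" i] by (simp add: power_mult)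
  have "2 * (m / 2 + 1 / 2) = m + 1" "m / 2 + 1 / 2 + 1 / 2 = m / 2 + 1"
    by (simp_all add: field_simps)
  then have d2: "pochhammer (m / 2 + 1) i * pochhammer (m / 2 + 1 / 2) i = pochhammer (m + 1) (2 * i) / 4 ^ i"
    using pochhammer_double[of "m / 2 + 1 / 2" i] by (simp add: power_mult power2_eq_square add_ac mult_ac flip: power_mult_distrib)
  have m: "m = - of_nat (n - k)" "m + 1 = - of_nat (n - k - 1)" "- of_nat n + 1 + of_nat k = m + 1"
    "- of_nat n + 1 = (- of_nat (n - 1) :: 'a)"
    using assms(1) by (simp_all add: m_def of_nat_diff)
  have C: "fps_hypergeo [m / 2, m / 2 + 1, m / 2 + 1 / 2, m / 2 + 1 / 2]
             [- of_nat n + 1, of_nat k + 1, - of_nat n + 1 + of_nat k] (4 / x ^ 2) $ i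
         = (pochhammer m (2 * i) / 4 ^ i) * (pochhammer (m + 1) (2 * i) / 4 ^ i) * (4 / x\<^sup>2) ^ i /
            (pochhammer (- of_nat n + 1) i * pochhammer (of_nat k + 1) i * pochhammer (m + 1) i * fact i)"
    unfolding d1[symmetric] d2[symmetric] m(3) by (simp add: mult_ac)
  show ?thesis
  proof (cases "2 * i = n - k")
    \<comment> \<open>Both sides vanish at this last index: \<open>m + 1 = -(2 * i - 1)\<close>, so
      the Pochhammer product of length \<open>2 * i\<close> runs through 0.\<close>
    case True
    then have "pochhammer (m + 1) (2 * i) = 0"
      unfolding m(2) pochhammer_of_nat_eq_0_iff using assms by simp
    moreover have "(n - k - i - 1 choose i) = 0"
      using True assms(1) by (intro binomial_eq_0) auto
    ultimately show ?thesis unfolding C by simp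
  next
    case False
    \<comment> \<open>\<open>Suc j\<close> is the exponent of \<open>-2 * x\<close>; with it,
      \<open>n\<close> and all differences become subtraction-free sums.\<close>
    define j where "j = n - k - 2 * i - 1"
    have n: "n = k + 2 * i + Suc j" using False assms by (simp add: j_def)
    have s: "n - k = 2 * i + Suc j" "n - k - 1 = 2 * i + j" "n - 1 = k + 2 * i + j"
      "n - i = Suc (k + i + j)" "n - k - 2 * i = Suc j" "n - k - i - 1 = i + j"
      using n by auto
    have f1: "fact n = (of_nat n * fact (k + 2 * i + j) :: 'a)" using n by simp
    have b: "of_nat (n choose k) = (of_nat n * fact (k + 2 * i + j) / (fact k * fact (2 * i + Suc j)) :: 'a)"
       unfolding f1[symmetric] s(1)[symmetric] using assms(1) by (simp add: binomial_fact)
    have b': "of_nat (Suc (k + i + j) choose Suc j) = (fact (Suc (k + i + j)) / (fact (Suc j) * fact (k + i)) :: 'a)"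
       "of_nat (i + j choose i) = (fact (i + j) / (fact i * fact j) :: 'a)"
      by (subst binomial_fact; simp add: add.assoc)+
    have p: "pochhammer m (2 * i) = fact (2 * i + Suc j) / fact (Suc j)"
       "pochhammer (m + 1) (2 * i) = fact (2 * i + j) / fact j"
       "pochhammer (m + 1) i = (-1) ^ i * fact (2 * i + j) / fact (i + j)"
       "pochhammer (- of_nat n + 1 :: 'a) i = (-1) ^ i * fact (k + 2 * i + j) / fact (k + i + j)"
      unfolding m(2,4) unfolding m(1) s by (subst pochhammer_neg_of_nat; simp add: algebra_simps)+
    have pw: "(- 2 * x) ^ (2 * i + Suc j) = (4 * x\<^sup>2) ^ i * (- 2 * x) ^ Suc j"
      by (simp add: power_add power_mult power_mult_distrib)
    \<comment> \<open>The powers of 4 and \<open>x\<close> cancel: \<open>(4 * x^2)^i\<close> is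
      split off \<open>(-2 * x)^(n - k)\<close>, and the two factors \<open>4^i\<close> come from
      duplication. The signs \<open>(-1)^i\<close> of the two negative lower parameters cancel as
      well.\<close>
    have q: "(4 * x\<^sup>2) ^ i * ((4 / x\<^sup>2) ^ i / (4 ^ i * 4 ^ i)) = 1"
      using assms(3) by (simp add: power_mult_distrib power_divide)
    have e: "(-1 :: 'a) ^ i * (-1) ^ i = 1" by (simp flip: power_mult_distrib)
    have f2: "fact (Suc (k + i + j)) = (of_nat (Suc (k + i + j)) * fact (k + i + j) :: 'a)" by simp
    have "of_nat (n choose k) * (- 2 * x) ^ (n - k) *
           fps_hypergeo [m / 2, m / 2 + 1, m / 2 + 1 / 2, m / 2 + 1 / 2]
             [- of_nat n + 1, of_nat k + 1, - of_nat n + 1 + of_nat k] (4 / x ^ 2) $ i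
      = of_nat n * fact (k + i + j) * fact (i + j) / (fact j * fact (Suc j) * fact (k + i) * fact i)
        * ((4 * x\<^sup>2) ^ i * ((4 / x\<^sup>2) ^ i / (4 ^ i * 4 ^ i))) * (- 2 * x) ^ Suc j / ((-1 :: 'a) ^ i * (-1) ^ i)"
      unfolding C p pochhammer_of_nat_add_one b s(1) pw by (simp add: divide_simps del: fact_Suc power_Suc)
    also have "\<dots> = of_nat n * fact (k + i + j) * fact (i + j) / (fact j * fact (Suc j) * fact (k + i) * fact i)
        * (- 2 * x) ^ Suc j"
      unfolding q e by simp
    also have "\<dots> = of_nat n / of_nat (n - i) * of_nat (n - i choose (n - k - 2 * i))
             * of_nat (n - k - i - 1 choose i) * (- 2 * x) ^ (n - k - 2 * i)"
      unfolding s(4-6) b' f2 by (simp add: divide_simps del: fact_Suc power_Suc of_nat_Suc)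
    finally show ?thesis .
  qed
qed

section \<open>Chebyshev polynomials in the variable w\<close>

text \<open>The denominator of the generating function factors as
  \<open>(1 - w t) (1 - t/w)\<close>, and the numerator is the mean of these two factors, so the
  quotient is the mean of two geometric series.\<close>

lemma chebyshev_T_eq:
  fixes w :: "'a::field_char_0"
  assumes "w \<noteq> 0"
  shows "chebyshev_T k ((w + inverse w) / 2) = (w ^ k + inverse w ^ k) / 2"
proof -
  define x where "x = (w + inverse w) / 2"
  have "2 * x = w + inverse w" by (simp add: x_def)
  then have c: "fps_const (2 * x) = fps_const w + fps_const (inverse w)"
    "fps_const x = fps_const (1/2) * (fps_const w + fps_const (inverse w))"
    by (simp_all only: fps_const_add fps_const_mult) (simp_all add: x_def)
  have one: "fps_const w * fps_const (inverse w) = 1" using assms by simp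
  have half: "fps_const (1/2 :: 'a) * 2 = 1" by (simp add: fps_numeral_fps_const)
  let ?D = "1 - fps_const (2 * x) * fps_X + fps_X ^ 2"
  let ?A = "1 - fps_const w * fps_X" and ?B = "1 - fps_const (inverse w) * fps_X"
  have D: "?D = ?A * ?B"
    unfolding c using one by algebra
  have inv: "inverse ?A * ?A = 1" "inverse ?B * ?B = 1"
    by (rule inverse_mult_eq_1; simp)+
  have "(1 - fps_const x * fps_X) / ?D = (1 - fps_const x * fps_X) * (inverse ?A * inverse ?B)"
    unfolding D by (subst fps_divide_unit) (simp_all add: fps_inverse_mult)
  also have "\<dots> = fps_const (1/2) * (inverse ?A + inverse ?B)"
    using inv one half unfolding c by algebra
  finally show ?thesis
    using one_minus_const_fps_X_neg_power'[of 1 w] one_minus_const_fps_X_neg_power'[of 1 "inverse w"]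
    unfolding chebyshev_T_def x_def[symmetric] by simp
qed

text \<open>\<open>w\<close> is a root of \<open>w^2 - 2 x w + 1 = 0\<close>; the product of the two
  roots \<open>x + s\<close> and \<open>x - s\<close> is 1.\<close>

lemma complex_eq_inverse_mean:
  fixes x :: complex
  obtains w where "w \<noteq> 0" "x = (w + inverse w) / 2"
proof -
  define s where "s = csqrt (x\<^sup>2 - 1)"
  have s: "(x + s) * (x - s) = 1"
    using power2_csqrt[of "x\<^sup>2 - 1"] by (simp add: s_def power2_eq_square algebra_simps)
  then have "x + s \<noteq> 0" by auto
  moreover have "inverse (x + s) = x - s" using s by (rule inverse_unique)
  ultimately show ?thesis by (intro that[of "x + s"]) auto
qed

section \<open>The full sum via a logarithmic derivative\<close>

text \<open>
  The logarithmic derivative of \<open>(1-U) (1-wt) (1-t/w) = 1 + t\<^sup>2\<close>; the series composed with \<open>U\<close> is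
  \<open>- log (1-t)\<close>, its constant coefficient being \<open>1/0 = 0\<close>.
\<close>

lemma log_derivative_identity:
  fixes w :: "'a::field_char_0"
  assumes "w \<noteq> 0"
  defines "v \<equiv> inverse w"
  defines "A \<equiv> 1 - fps_const w * fps_X" and "B \<equiv> 1 - fps_const v * fps_X"
  defines "U \<equiv> fps_const (- (w + v)) * fps_X * inverse A * inverse B"
  shows "fps_X * fps_deriv (Abs_fps (\<lambda>j. 1 / of_nat j) oo U)
           + fps_const w * fps_X * inverse A + fps_const v * fps_X * inverse B
         = - 2 * fps_X\<^sup>2 * inverse (1 + fps_X\<^sup>2)"
proof -
  let ?F = "Abs_fps (\<lambda>j. 1 / of_nat j) :: 'a fps"
  have one: "fps_const w * fps_const v = 1" using assms by simp
  have inv: "inverse A * A = 1" "inverse B * B = 1" "inverse (1 + fps_X\<^sup>2) * (1 + fps_X\<^sup>2 :: 'a fps) = 1"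
    unfolding A_def B_def by (rule inverse_mult_eq_1; simp)+
  have U0: "U $ 0 = 0" by (simp add: U_def)
  have "fps_deriv ?F * (1 - fps_X) = 1"
    by (rule fps_ext) (auto simp: right_diff_distrib fps_mult_fps_X_commute[symmetric] simp flip: of_nat_Suc)
  then have "(fps_deriv ?F * (1 - fps_X)) oo U = 1" by simp
  then have G: "(fps_deriv ?F oo U) * (1 - U) = 1"
    by (simp add: fps_compose_mult_distrib U0 fps_compose_sub_distrib)
  have UD: "U * (A * B) = fps_const (- (w + v)) * fps_X"
    unfolding U_def using inv by algebra
  have c: "fps_const (- (w + v)) = - (fps_const w + fps_const v)" by simp
  \<comment> \<open>\<open>A * B = 1 - (w + v) t + t^2\<close>, and subtracting
    \<open>U * (A * B)\<close> removes the linear term.\<close>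
  have U1: "(1 - U) * (A * B) = 1 + fps_X\<^sup>2"
    using UD one unfolding A_def B_def c by algebra
  have dA: "fps_deriv A = - fps_const w" and dB: "fps_deriv B = - fps_const v"
    unfolding A_def B_def by simp_all
  have "fps_deriv (U * (A * B)) = fps_const (- (w + v))"
    unfolding UD by simp
  then have dU: "fps_deriv U * (A * B) + U * (- fps_const w * B - A * fps_const v) = - (fps_const w + fps_const v)"
    unfolding fps_deriv_mult dA dB c by algebra
  define d where "d = fps_deriv (?F oo U)"
  have H: "d * (1 - U) = fps_deriv U"
    using G unfolding d_def fps_compose_deriv[OF U0] by algebra
  \<comment> \<open>Multiplying by \<open>(1 + t^2) A B\<close> clears denominators:
    \<open>H\<close> eliminates \<open>d\<close>, then \<open>dU\<close> and \<open>UD\<close>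
    eliminate \<open>U\<close> and its derivative. What remains is a polynomial identity modulo
    \<open>w v = 1\<close>.\<close>
  have "(fps_X * d + fps_const w * fps_X * inverse A + fps_const v * fps_X * inverse B)
      * ((1 + fps_X\<^sup>2) * (A * B)) = - 2 * fps_X\<^sup>2 * (A * B)"
  proof -
    have 1: "d * (1 + fps_X\<^sup>2) * (A * B) = fps_deriv U * (A * B) * (A * B)"
      unfolding H[symmetric] U1[symmetric] by (simp only: mult_ac)
    have 2: "fps_deriv U * (A * B) * (A * B) = - (fps_const w + fps_const v) * (A * B) 
       - (fps_const w + fps_const v) * fps_X * (fps_const w * B + A * fps_const v)"
      using dU UD unfolding c by algebra
    have 3: "(fps_const w * fps_X * inverse A + fps_const v * fps_X * inverse B) * (A * B)
      = fps_X * (fps_const w * B + A * fps_const v)" using inv by algebra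
    have 4: "fps_X * (- (fps_const w + fps_const v) * (A * B) 
       - (fps_const w + fps_const v) * fps_X * (fps_const w * B + A * fps_const v))
       + fps_X * (fps_const w * B + A * fps_const v) * (1 + fps_X\<^sup>2) = - 2 * fps_X\<^sup>2 * (A * B)"
      using one unfolding A_def B_def by algebra
    show ?thesis using 1 2 3 4 by algebra
  qed
  then show ?thesis using inv unfolding d_def[symmetric] by algebra
qed

lemma inverse_one_plus_fps_X_squared:
  "inverse (1 + fps_X\<^sup>2 :: 'a::field fps) = Abs_fps (\<lambda>n. if even n then (-1) ^ (n div 2) else 0)"
    (is "_ = ?f")
proof -
  have "(1 + fps_X\<^sup>2) * ?f = 1"
  proof (rule fps_ext)
    fix n
    consider "n = 0" | "n = 1" | m where "n = Suc (Suc m)" by (metis One_nat_def not0_implies_Suc)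
    then show "((1 + fps_X\<^sup>2) * ?f) $ n = 1 $ n"
      by cases (auto simp: distrib_right fps_X_power_mult_nth)
  qed
  then show ?thesis by (rule fps_inverse_unique)
qed

text \<open>This compares the coefficients of \<open>t^n\<close> in
  \<open>log_derivative_identity\<close>. The inner sum is the convolution of the negative binomial
  series of \<open>A^(-j)\<close> and \<open>B^(-j)\<close>; the two single powers come from the
  geometric series.\<close>

lemma sum_convolution_eq:
  fixes w :: "'a::field_char_0"
  assumes "w \<noteq> 0" "n > 0"
  shows "(\<Sum>j=1..n. of_nat n / of_nat j * (- (w + inverse w)) ^ j *
           (\<Sum>i\<le>n - j. of_nat (i + j - 1 choose i) * of_nat (n - j - i + j - 1 choose (n - j - i))
                         * (w ^ i * inverse w ^ (n - j - i))))
           + w ^ n + inverse w ^ n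
         = (if even n then 2 * (-1) ^ (n div 2) else 0)"
proof -
  define v where "v = inverse w"
  define A B where "A = 1 - fps_const w * fps_X" and "B = 1 - fps_const v * fps_X"
  define U where "U = fps_const (- (w + v)) * fps_X * inverse A * inverse B"
  define F where "F = Abs_fps (\<lambda>j. 1 / of_nat j :: 'a)"
  define S where "S j = (\<Sum>i\<le>n - j. of_nat (i + j - 1 choose i) * of_nat (n - j - i + j - 1 choose (n - j - i))
                         * (w ^ i * v ^ (n - j - i)))" for j
  have U_power: "(U ^ j) $ n = (- (w + v)) ^ j * S j" if j: "j \<in> {1..n}" for j
  proof -
    have "U ^ j = fps_const ((- (w + v)) ^ j) * (fps_X ^ j * (inverse (A ^ j) * inverse (B ^ j)))"
      unfolding U_def by (simp only: power_mult_distrib fps_const_power fps_inverse_power mult.assoc)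
    also have "\<dots> $ n = (- (w + v)) ^ j * (inverse (A ^ j) * inverse (B ^ j)) $ (n - j)"
      using j by (simp add: fps_X_power_mult_nth)
    also have "(inverse (A ^ j) * inverse (B ^ j)) $ (n - j) = S j"
    proof -
      have "j > 0" using j by simp
      then show ?thesis
        unfolding A_def B_def S_def one_minus_const_fps_X_neg_power'[OF \<open>j > 0\<close>] fps_mult_nth
        by (simp add: atLeast0AtMost add.commute mult_ac)
    qed
    finally show ?thesis .
  qed
  \<comment> \<open>The term \<open>j = 0\<close> drops out because
    \<open>F $ 0 = 1 / 0 = 0\<close>. Applying \<open>t d/dt\<close> afterwards supplies the factor
    \<open>n\<close>.\<close>
  have "(F oo U) $ n = (\<Sum>j=1..n. F $ j * (U ^ j) $ n)"
    unfolding fps_compose_nth by (simp add: sum.atLeast_Suc_atMost F_def)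
  also have "\<dots> = (\<Sum>j=1..n. 1 / of_nat j * (- (w + v)) ^ j * S j)"
    by (intro sum.cong refl) (simp add: U_power F_def)
  finally have "(fps_X * fps_deriv (F oo U)) $ n
      = (\<Sum>j=1..n. of_nat n / of_nat j * (- (w + v)) ^ j * S j)"
    using assms(2) by (simp add: sum_distrib_left mult.assoc)
  moreover have "(fps_const w * fps_X * inverse A) $ n = w ^ n" "(fps_const v * fps_X * inverse B) $ n = v ^ n"
    using assms(2) one_minus_const_fps_X_neg_power'[of 1 w] one_minus_const_fps_X_neg_power'[of 1 v]
    by (simp_all add: A_def B_def mult.assoc power_eq_if)
  \<comment> \<open>The shift by \<open>t^2\<close> turns the sign into
    \<open>(-1)^((n - 2) div 2) = - (-1)^(n div 2)\<close>, which absorbs the minus of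
    \<open>-2\<close>.\<close>
  moreover have "(- 2 * fps_X\<^sup>2 * inverse (1 + fps_X\<^sup>2)) $ n = (if even n then 2 * (-1) ^ (n div 2) else 0 :: 'a)"
  proof -
    consider "n = 1" | m where "n = Suc (Suc m)" using assms(2) by (metis One_nat_def not0_implies_Suc less_nat_zero_code)
    moreover have "- 2 * fps_X\<^sup>2 * inverse (1 + fps_X\<^sup>2) = fps_const (- 2 :: 'a) * (fps_X\<^sup>2 * inverse (1 + fps_X\<^sup>2))"
      by (simp add: numeral_fps_const mult.assoc)
    ultimately show ?thesis
      unfolding inverse_one_plus_fps_X_squared by cases (simp_all add: fps_X_power_mult_nth)
  qed
  moreover have "(fps_X * fps_deriv (F oo U) + fps_const w * fps_X * inverse A + fps_const v * fps_X * inverse B) $ n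
      = (- 2 * fps_X\<^sup>2 * inverse (1 + fps_X\<^sup>2)) $ n"
    using log_derivative_identity[OF assms(1)] unfolding F_def U_def A_def B_def v_def by simp
  ultimately show ?thesis
    unfolding S_def v_def fps_add_nth by simp
qed

section \<open>Reindexing and symmetry of the sums\<close>

text \<open>Reflection \<open>i -> m - i\<close> maps the lower half onto the upper half; they
  overlap only in the midpoint of an even \<open>m\<close>, which is therefore counted
  twice.\<close>

lemma sum_fold_half:
  fixes F :: "nat \<Rightarrow> 'a::comm_monoid_add"
  shows "(\<Sum>i\<le>m. F i) + (if even m then F (m div 2) else 0) = (\<Sum>i\<le>m div 2. F i + F (m - i))"
proof -
  let ?A = "{..m div 2}" and ?B = "(\<lambda>i. m - i) ` {..m div 2}"
  have U: "?A \<union> ?B = {..m}"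
  proof -
    have "i \<in> ?A \<union> ?B" if "i \<le> m" for i
      using that by (cases "i \<le> m div 2") (auto intro!: image_eqI[of _ _ "m - i"])
    then show ?thesis by auto
  qed
  have I: "?A \<inter> ?B = (if even m then {m div 2} else {})"
    by (auto simp: image_iff intro!: bexI[of _ "m div 2"]; presburger)
  have "(\<Sum>i\<in>?A \<union> ?B. F i) + (\<Sum>i\<in>?A \<inter> ?B. F i) = (\<Sum>i\<in>?A. F i) + (\<Sum>i\<in>?B. F i)"
    by (rule sum.union_inter) auto
  moreover have "(\<Sum>i\<in>?B. F i) = (\<Sum>i\<in>?A. F (m - i))"
    by (subst sum.reindex) (auto simp: inj_on_def)
  ultimately show ?thesis unfolding U I by (simp add: sum.distrib split: if_splits)
qed

text \<open>Both sides run over the triples with \<open>k + 2 * i + j = n\<close>. This passes from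
  grouping by the Chebyshev index \<open>k\<close> to grouping by the exponent \<open>j\<close> of
  \<open>-2 * x\<close>.\<close>

lemma sum_triples_swap:
  fixes P :: "nat \<Rightarrow> nat \<Rightarrow> nat \<Rightarrow> 'a::comm_monoid_add"
  shows "(\<Sum>k=0..n. \<Sum>i\<le>(n - k) div 2. P i (n - k - 2 * i) k)
       = (\<Sum>j=0..n. \<Sum>i\<le>(n - j) div 2. P i j (n - j - 2 * i))"
  unfolding sum.Sigma[OF finite_atLeastAtMost ballI[OF finite_atMost]]
  by (rule sum.reindex_bij_witness[where i = "\<lambda>(j, i). (n - j - 2 * i, i)" and j = "\<lambda>(k, i). (n - k - 2 * i, i)"]) auto

text \<open>By absorption, \<open>j C(n-i, j) = (n-i) C(n-i-1, j-1)\<close>, so \<open>n - i\<close>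
  cancels. The last binomial is \<open>C(l+j-1, l)\<close> for \<open>l = n - j - i\<close>, which
  exposes the symmetry in \<open>i\<close> and \<open>l\<close>.\<close>

lemma coeff_symmetric_form:
  assumes "j > 0" "j + i \<le> n"
  shows "of_nat n / of_nat (n - i) * of_nat (n - i choose j) * of_nat (i + j - 1 choose i)
       = (of_nat n / of_nat j * of_nat (i + j - 1 choose i) * of_nat (n - j - i + j - 1 choose (n - j - i)) :: 'a::field_char_0)"
proof -
  have "n - j - i + j - 1 choose (n - j - i) = n - i - 1 choose (j - 1)"
    using assms binomial_symmetric[of "n - j - i" "n - j - i + j - 1"] by simp
  moreover have "j * (n - i choose j) = (n - i) * (n - i - 1 choose (j - 1))"
    using assms times_binomial_minus1_eq[of j "n - i"] by simp
  then have "of_nat j * of_nat (n - i choose j) = (of_nat (n - i) * of_nat (n - i - 1 choose (j - 1)) :: 'a)"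
    by (metis of_nat_mult)
  moreover have "of_nat (n - i) \<noteq> (0 :: 'a)" using assms by (simp del: of_nat_diff)
  ultimately show ?thesis using assms by (simp add: divide_simps mult_ac del: of_nat_diff)
qed

section \<open>The terms of the right-hand side\<close>

text \<open>For even \<open>n - k\<close> put \<open>p = (n + k) / 2\<close>. Absorption,
  \<open>k C(p, k) = p C(p-1, k-1)\<close>, cancels the \<open>p^2\<close> in
  \<open>(n + k)^2 = 4 p^2\<close>; the result is half of a diagonal term
  \<open>i = l\<close>.\<close>

lemma squared_gbinomial_term:
  fixes x :: "'a::field_char_0"
  assumes "k \<in> {1..n}"
  shows "of_nat n * ((1 + (-1) ^ (n - k)) * (of_nat k * (-2) ^ k / (of_nat n + of_nat k) ^ 2) *
            (((of_nat n + of_nat k) / 2) gchoose k) ^ 2 * x ^ k)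
       = (if even (n - k) then of_nat n / (2 * of_nat k) * (-2 * x) ^ k
            * of_nat ((n - k) div 2 + k - 1 choose ((n - k) div 2)) ^ 2 else 0)"
proof (cases "even (n - k)")
  case True
  define i where "i = (n - k) div 2"
  have n: "n = 2 * i + k" using True assms by (auto simp: i_def)
  define p where "p = i + k"
  have p: "of_nat n + of_nat k = (2 * of_nat p :: 'a)" by (simp add: n p_def)
  have "k * (p choose k) = p * (p - 1 choose (k - 1))"
    using assms times_binomial_minus1_eq[of k p] by simp
  also have "(p - 1 choose (k - 1)) = (i + k - 1 choose i)"
    using assms binomial_symmetric[of i "i + k - 1"] by (auto simp: p_def)
  finally have b: "of_nat k * of_nat (p choose k) = (of_nat p * of_nat (i + k - 1 choose i) :: 'a)"
    by (metis of_nat_mult)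
  have k: "of_nat k \<noteq> (0 :: 'a)" and p0: "of_nat p \<noteq> (0 :: 'a)" using assms by (auto simp: p_def simp del: of_nat_add)
  have c: "of_nat (p choose k) = (of_nat p * of_nat (i + k - 1 choose i) / of_nat k :: 'a)"
    using b k by (simp add: field_simps)
  have g: "(((of_nat n + of_nat k) / 2) gchoose k) = (of_nat p * of_nat (i + k - 1 choose i) / of_nat k :: 'a)"
    using c unfolding p by (simp add: binomial_gbinomial)
  show ?thesis
    using True k p0 unfolding g unfolding p i_def[symmetric] power_mult_distrib[of "-2" x]
    by (simp add: field_simps power2_eq_square)
qed simp

lemma cos_pi_half_nat:
  "of_real (cos (pi * real n / 2)) = (if even n then (-1) ^ (n div 2) else 0 :: complex)"
proof (cases "even n")
  case True
  then obtain m where m: "n = 2 * m" by blast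
  then have "cos (pi * real n / 2) = cos (pi * real m)" by simp
  then show ?thesis using m by (simp add: mult.commute[of pi])
next
  case False
  then obtain m where m: "n = 2 * m + 1" by (rule oddE)
  then have "pi * real n / 2 = real m * pi + pi / 2" by (simp add: field_simps)
  then have "cos (pi * real n / 2) = 0" by (simp only: cos_add) simp
  then show ?thesis using m by simp
qed

section \<open>Splitting the Chebyshev sum into full sum and diagonal\<close>

theorem theorem2:
  fixes n :: nat and x :: complex
  assumes "n \<ge> 1" and "x \<noteq> 0"
  shows
    "(\<Sum>k=0..n. of_nat (n choose k) * (- 2 * x) ^ (n - k) *
        hypergeo_upto ((n - k) div 2)
          [(- of_nat n + of_nat k) / 2,
           (- of_nat n + of_nat k) / 2 + 1,
           (- of_nat n + of_nat k) / 2 + 1 / 2,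
           (- of_nat n + of_nat k) / 2 + 1 / 2]
          [- of_nat n + 1, of_nat k + 1, - of_nat n + 1 + of_nat k]
          (4 / x ^ 2) *
        chebyshev_T k x)
     = of_nat n * (\<Sum>k=0..n. (1 + (- 1) ^ (n - k)) *
          (of_nat k * (- 2) ^ k / (of_nat n + of_nat k) ^ 2) *
          (((of_nat n + of_nat k) / 2) gchoose k) ^ 2 * x ^ k)
       + of_real (cos (pi * real n / 2))"
    (is "(\<Sum>k=0..n. ?L k) = _ * (\<Sum>k=0..n. ?R k) + _")
proof -
  obtain w where w: "w \<noteq> 0" "x = (w + inverse w) / 2"
    by (rule complex_eq_inverse_mean)
  define v where "v = inverse w"
  have wv: "w * v = 1" "- (w + v) = - 2 * x"
    using w(1) unfolding w(2) by (simp_all add: v_def)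
  have T: "chebyshev_T k x = (w ^ k + v ^ k) / 2" for k
    unfolding w(2) v_def by (rule chebyshev_T_eq[OF w(1)])
  define h where "h i j = of_nat n / of_nat (n - i) * of_nat (n - i choose j)
    * of_nat (i + j - 1 choose i) * (- 2 * x) ^ j" for i j :: nat
  define g :: "nat \<Rightarrow> nat \<Rightarrow> complex" where "g j i = of_nat (i + j - 1 choose i)" for i j
  \<comment> \<open>For fixed \<open>j\<close>, \<open>a j * S j\<close> is the full sum over
    \<open>i + l = n - j\<close>, and \<open>a j * d j\<close> is its diagonal
    \<open>i = l\<close>.\<close>
  define a where "a j = of_nat n / of_nat j * (- 2 * x) ^ j" for j :: nat
  define S where "S j = (\<Sum>i\<le>n - j. g j i * g j (n - j - i) * (w ^ i * v ^ (n - j - i)))" for j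
  define d where "d j = (if even (n - j) then g j ((n - j) div 2) ^ 2 else 0)" for j

  have L: "?L k = (\<Sum>i\<le>(n - k) div 2. h i (n - k - 2 * i) * chebyshev_T k x)" if "k \<le> n" for k
  proof (cases "k = n")
    \<comment> \<open>Only \<open>i = 0\<close> occurs, and \<open>h 0 0 = 1\<close> since
      \<open>0 + 0 - 1\<close> is truncated to 0.\<close>
    case True
    then show ?thesis using assms by (simp add: hypergeo_upto_def h_def)
  next
    case False
    have "h i (n - k - 2 * i) = of_nat (n choose k) * (- 2 * x) ^ (n - k) *
        fps_hypergeo [(- of_nat n + of_nat k) / 2,
           (- of_nat n + of_nat k) / 2 + 1,
           (- of_nat n + of_nat k) / 2 + 1 / 2,
           (- of_nat n + of_nat k) / 2 + 1 / 2]
          [- of_nat n + 1, of_nat k + 1, - of_nat n + 1 + of_nat k]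
          (4 / x ^ 2) $ i" if i: "i \<le> (n - k) div 2" for i
    proof -
      have "i + (n - k - 2 * i) - 1 = n - k - i - 1" using i by linarith
      then show ?thesis
        using hypergeo_coeff[of k n i x] i False \<open>k \<le> n\<close> assms(2) unfolding h_def by simp
    qed
    then show ?thesis
      unfolding hypergeo_upto_def sum_distrib_left sum_distrib_right by (intro sum.cong refl) simp
  qed
  \<comment> \<open>The symmetric form divides by \<open>j\<close>, so \<open>j = 0\<close> is
    separate: \<open>i - 1 choose i\<close> is 0 for \<open>i > 0\<close> and, by truncation, 1 for
    \<open>i = 0\<close>.\<close>
  have h0: "(\<Sum>i\<le>n div 2. h i 0 * chebyshev_T (n - 2 * i) x) = chebyshev_T n x"
  proof -
    have "h i 0 * chebyshev_T (n - 2 * i) x = (if i = 0 then chebyshev_T n x else 0)" for i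
      using assms(1) by (simp add: h_def)
    then show ?thesis by simp
  qed
  have hj: "(\<Sum>i\<le>(n - j) div 2. h i j * chebyshev_T (n - j - 2 * i) x) = a j * (S j + d j) / 2"
    if j: "j \<in> {1..n}" for j
  proof -
    define F where "F i = g j i * g j (n - j - i) * (w ^ i * v ^ (n - j - i))" for i
    have "h i j * chebyshev_T (n - j - 2 * i) x = a j * (F i + F (n - j - i)) / 2"
      if i: "i \<le> (n - j) div 2" for i
    proof -
      have s: "n - j - i = (n - j - 2 * i) + i" "n - j - (n - j - i) = i" using i by auto
      \<comment> \<open>Since \<open>w v = 1\<close>, the terms at \<open>i\<close> and at its
        mirror image carry the two powers that add up to
        \<open>2 * chebyshev_T (n - j - 2 * i) x\<close>.\<close>
      have "w ^ i * v ^ (n - j - i) = v ^ (n - j - 2 * i)" "w ^ (n - j - i) * v ^ i = w ^ (n - j - 2 * i)"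
        unfolding s(1) power_add using wv(1) by (simp_all add: mult_ac flip: power_mult_distrib)
      then have F: "F i + F (n - j - i) = g j i * g j (n - j - i) * (2 * chebyshev_T (n - j - 2 * i) x)"
        unfolding F_def s(2) T by (simp add: algebra_simps)
      have "h i j = a j * (g j i * g j (n - j - i))"
      proof -
        have "j > 0" "j + i \<le> n" using i j by auto
        then show ?thesis unfolding h_def g_def a_def coeff_symmetric_form[OF \<open>j > 0\<close> \<open>j + i \<le> n\<close>] by simp
      qed
      then show ?thesis unfolding F by simp
    qed
    then have "(\<Sum>i\<le>(n - j) div 2. h i j * chebyshev_T (n - j - 2 * i) x)
        = a j / 2 * (\<Sum>i\<le>(n - j) div 2. F i + F (n - j - i))"
      unfolding sum_distrib_left by (intro sum.cong refl) simp
    also have "(\<Sum>i\<le>(n - j) div 2. F i + F (n - j - i)) = S j + (if even (n - j) then F ((n - j) div 2) else 0)"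
      using sum_fold_half[of F "n - j"] unfolding F_def S_def by simp
    also have "(if even (n - j) then F ((n - j) div 2) else 0) = d j"
    proof (cases "even (n - j)")
      case True
      then obtain m where m: "n - j = 2 * m" by blast
      have "w ^ m * v ^ m = 1"
        using wv(1) by (simp flip: power_mult_distrib)
      then show ?thesis unfolding F_def d_def m by (simp add: power2_eq_square)
    qed (simp add: d_def)
    finally show ?thesis by simp
  qed
  have R: "of_nat n * ?R k = a k * d k / 2" if "k \<in> {1..n}" for k
    unfolding squared_gbinomial_term[OF that] by (simp add: a_def d_def g_def)

  have total: "(\<Sum>j=1..n. a j * S j) + w ^ n + v ^ n = (if even n then 2 * (-1) ^ (n div 2) else 0)"
    using sum_convolution_eq[OF w(1), of n] assms(1)
    unfolding v_def[symmetric] wv(2) a_def S_def g_def by simp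

  have hj_sum: "(\<Sum>j=1..n. \<Sum>i\<le>(n - j) div 2. h i j * chebyshev_T (n - j - 2 * i) x)
      = (\<Sum>j=1..n. a j * (S j + d j) / 2)"
    by (intro sum.cong refl hj)
  have R_sum: "(\<Sum>k=1..n. of_nat n * ?R k) = (\<Sum>k=1..n. a k * d k / 2)"
    by (intro sum.cong refl R)
  have "(\<Sum>k=0..n. ?L k) = (\<Sum>k=0..n. \<Sum>i\<le>(n - k) div 2. h i (n - k - 2 * i) * chebyshev_T k x)"
    by (intro sum.cong refl L) simp
  also have "\<dots> = (\<Sum>j=0..n. \<Sum>i\<le>(n - j) div 2. h i j * chebyshev_T (n - j - 2 * i) x)"
    by (rule sum_triples_swap)
  also have "\<dots> = chebyshev_T n x + (\<Sum>j=1..n. a j * (S j + d j) / 2)"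
    unfolding hj_sum[symmetric] using h0 by (simp add: sum.atLeast_Suc_atMost)
  \<comment> \<open>The contribution of \<open>j = 0\<close> is \<open>(w^n + v^n) / 2\<close>,
    exactly what completes the sum in \<open>total\<close>.\<close>
  also have "\<dots> = ((\<Sum>j=1..n. a j * S j) + w ^ n + v ^ n) / 2 + (\<Sum>j=1..n. a j * d j / 2)"
    unfolding T by (simp add: distrib_left add_divide_distrib sum.distrib sum_divide_distrib)
  also have "\<dots> = (\<Sum>k=1..n. of_nat n * ?R k) + of_real (cos (pi * real n / 2))"
    unfolding total cos_pi_half_nat R_sum by simp
  \<comment> \<open>The term \<open>k = 0\<close> vanishes through its factor
    \<open>of_nat k\<close>.\<close>
  also have "(\<Sum>k=1..n. of_nat n * ?R k) = of_nat n * (\<Sum>k=0..n. ?R k)"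
    by (simp add: sum_distrib_left sum.atLeast_Suc_atMost)
  finally show ?thesis .
qed

end
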